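(* Consider the model and prior $$X\mid\theta,\alpha\sim f_\theta(x),\qquad \theta\mid\alpha\sim g_1(\theta)\,\mathbb{I}_{[0,\infty)}(\theta-\alpha),\qquad \alpha\sim g_2(\alpha),$$ where $g_1\geq 0$ is a (possibly improper) density with respect to Lebesgue measure on $\mathbb{R}$, and $g_2\ge 0$ is a (possibly improper) density with respect to a $\sigma$-finite measure $\mu$ on $\mathbb{R}$ such that $\int_{-\infty}^t g_2(\alpha)\,d\mu(\alpha)<\infty$ for all $t\in\mathbb{R}$; for the posterior of $\alpha$, assume also $\int_s^\infty g_1(\theta)\,d\theta<\infty$ for all $s\in\mathbb{R}$. Then, whenever they exist, the marginal posterior densities of $\theta$ (with respect to Lebesgue measure) and of $\alpha$ (with respect to $\mu$) given $X=x$ are respectively $$\pi_1(\theta\mid x)\;\propto\; f_\theta(x)\,g_1(\theta)\int_{-\infty}^{\theta}g_2(\alpha)\,d\mu(\alpha),$$ $$\pi_2(\alpha\mid x)\;\propto\; g_2(\alpha)\int_\alpha^\infty f_\theta(x)\,g_1(\theta)\,d\theta .$$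
   Context: The distribution of $X$ given $(\theta,\alpha)$ depends only on $\theta$ and has density $f_\theta(\cdot)$ with respect to a fixed dominating measure. The model notation means that the joint (possibly improper) prior density of $(\theta,\alpha)$, with respect to the product of Lebesgue measure and $\mu$, is proportional to $g_1(\theta)\,g_2(\alpha)\,\mathbb{I}_{[0,\infty)}(\theta-\alpha)$, where $\mathbb{I}_A$ is the indicator function of $A$. Thus the joint posterior density of $(\theta,\alpha)$ given $X=x$ is proportional to $f_\theta(x)\,g_1(\theta)\,g_2(\alpha)\,\mathbb{I}_{[0,\infty)}(\theta-\alpha)$. The phrase "whenever they exist" means that the normalizing integrals are finite and positive. The symbol $\propto$ denotes equality up to a positive factor depending only on $x$. *)

theory Defs
  imports "HOL-Probability.Probability"
begin

definition proportional_to :: "('a \<Rightarrow> ennreal) \<Rightarrow> ('a \<Rightarrow> ennreal) \<Rightarrow> bool" where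
  "proportional_to p q \<longleftrightarrow> (\<exists>c::real. c > 0 \<and> (\<forall>t. p t = ennreal c * q t))"

text \<open>
  For a (possibly improper) prior density \<open>p\<close> with respect to \<open>B\<close> and a likelihood function \<open>L\<close>
  (the sampling density at the observed value, as a function of the parameter), the posterior is
  a probability measure only when the normalizing integral is finite and positive.
\<close>

definition normalizing_integral ::
    "'p measure \<Rightarrow> ('p \<Rightarrow> ennreal) \<Rightarrow> ('p \<Rightarrow> ennreal) \<Rightarrow> ennreal" where
  "normalizing_integral B p L = (\<integral>\<^sup>+\<omega>. L \<omega> * p \<omega> \<partial>B)"

definition posterior ::
    "'p measure \<Rightarrow> ('p \<Rightarrow> ennreal) \<Rightarrow> ('p \<Rightarrow> ennreal) \<Rightarrow> 'p measure" where
  "posterior B p L = density B (\<lambda>\<omega>. L \<omega> * p \<omega> / normalizing_integral B p L)"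

end

theory Submission
  imports Defs
begin

text \<open>
  Up to a positive constant \<open>d\<close>, the posterior has the joint density
  \<open>f\<^sub>\<theta>(x) g\<^sub>1(\<theta>) g\<^sub>2(\<alpha>) \<I>(\<alpha> \<le> \<theta>)\<close> with respect to the product of Lebesgue
  measure and \<open>\<mu>\<close>: the proportionality constant of the prior and the normalizing integral, which is
  finite and positive, combine into \<open>d\<close> (lemma \<open>posterior_density_proportional\<close>).
  By Tonelli's theorem a marginal density is obtained by integrating a joint density over the other
  coordinate (lemmas \<open>distributed_fst_density\<close> and \<open>distributed_snd_density\<close>). The indicator of
  \<open>\<alpha> \<le> \<theta>\<close> cuts the section at a fixed \<open>\<theta>\<close> down to the ray \<open>{..\<theta>}\<close> and the section at a
  fixed \<open>\<alpha>\<close> down to the ray \<open>{\<alpha>..}\<close>, and the factors that are constant on a section move out of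
  the integral; what is left are the two stated formulas.
\<close>

text \<open>
  Tonelli's theorem for the integral of \<open>h\<close> over the cylinder above a measurable set.
\<close>

lemma (in pair_sigma_finite) distributed_fst_density:
  assumes [measurable]: "h \<in> borel_measurable (M1 \<Otimes>\<^sub>M M2)"
  shows "distributed (density (M1 \<Otimes>\<^sub>M M2) h) M1 fst (\<lambda>x. \<integral>\<^sup>+y. h (x, y) \<partial>M2)"
  unfolding distributed_def
proof (intro conjI measure_eqI)
  fix A assume "A \<in> sets (distr (density (M1 \<Otimes>\<^sub>M M2) h) M1 fst)"
  then have A [measurable]: "A \<in> sets M1" by simp
  have "emeasure (distr (density (M1 \<Otimes>\<^sub>M M2) h) M1 fst) A
      = (\<integral>\<^sup>+z. h z * indicator (fst -` A \<inter> space (M1 \<Otimes>\<^sub>M M2)) z \<partial>(M1 \<Otimes>\<^sub>M M2))"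
    by (simp add: emeasure_distr emeasure_density)
  also have "\<dots> = (\<integral>\<^sup>+z. h z * indicator A (fst z) \<partial>(M1 \<Otimes>\<^sub>M M2))"
    by (intro nn_integral_cong) (auto split: split_indicator)
  also have "\<dots> = (\<integral>\<^sup>+x. \<integral>\<^sup>+y. h (x, y) * indicator A x \<partial>M2 \<partial>M1)"
    by (subst M2.nn_integral_fst [symmetric]) simp_all
  also have "\<dots> = (\<integral>\<^sup>+x. (\<integral>\<^sup>+y. h (x, y) \<partial>M2) * indicator A x \<partial>M1)"
    by (intro nn_integral_cong) (simp add: nn_integral_multc)
  also have "\<dots> = emeasure (density M1 (\<lambda>x. \<integral>\<^sup>+y. h (x, y) \<partial>M2)) A"
    by (simp add: emeasure_density)
  finally show "emeasure (distr (density (M1 \<Otimes>\<^sub>M M2) h) M1 fst) A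
      = emeasure (density M1 (\<lambda>x. \<integral>\<^sup>+y. h (x, y) \<partial>M2)) A" .
qed simp_all

lemma (in pair_sigma_finite) distributed_snd_density:
  assumes [measurable]: "h \<in> borel_measurable (M1 \<Otimes>\<^sub>M M2)"
  shows "distributed (density (M1 \<Otimes>\<^sub>M M2) h) M2 snd (\<lambda>y. \<integral>\<^sup>+x. h (x, y) \<partial>M1)"
  unfolding distributed_def
proof (intro conjI measure_eqI)
  fix A assume "A \<in> sets (distr (density (M1 \<Otimes>\<^sub>M M2) h) M2 snd)"
  then have A [measurable]: "A \<in> sets M2" by simp
  have "emeasure (distr (density (M1 \<Otimes>\<^sub>M M2) h) M2 snd) A
      = (\<integral>\<^sup>+z. h z * indicator (snd -` A \<inter> space (M1 \<Otimes>\<^sub>M M2)) z \<partial>(M1 \<Otimes>\<^sub>M M2))"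
    by (simp add: emeasure_distr emeasure_density)
  also have "\<dots> = (\<integral>\<^sup>+z. h z * indicator A (snd z) \<partial>(M1 \<Otimes>\<^sub>M M2))"
    by (intro nn_integral_cong) (auto split: split_indicator)
  also have "\<dots> = (\<integral>\<^sup>+y. \<integral>\<^sup>+x. h (x, y) * indicator A y \<partial>M1 \<partial>M2)"
    by (subst nn_integral_snd [symmetric]) simp_all
  also have "\<dots> = (\<integral>\<^sup>+y. (\<integral>\<^sup>+x. h (x, y) \<partial>M1) * indicator A y \<partial>M2)"
    by (intro nn_integral_cong) (simp add: nn_integral_multc)
  also have "\<dots> = emeasure (density M2 (\<lambda>y. \<integral>\<^sup>+x. h (x, y) \<partial>M1)) A"
    by (simp add: emeasure_density)
  finally show "emeasure (distr (density (M1 \<Otimes>\<^sub>M M2) h) M2 snd) A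
      = emeasure (density M2 (\<lambda>y. \<integral>\<^sup>+x. h (x, y) \<partial>M1)) A" .
qed simp_all

text \<open>
  Since the prior matters only up to a factor, it may be replaced by \<open>q\<close>: a finite positive
  normalizing integral and the factor between \<open>p\<close> and \<open>q\<close> combine into one real \<open>d > 0\<close>.
\<close>

lemma posterior_density_proportional:
  assumes "proportional_to p q"
    and "0 < normalizing_integral B p L" "normalizing_integral B p L < \<infinity>"
  obtains d :: real where "d > 0" "posterior B p L = density B (\<lambda>\<omega>. ennreal d * (L \<omega> * q \<omega>))"
proof -
  obtain c where c: "c > 0" "\<And>t. p t = ennreal c * q t"
    using assms(1) unfolding proportional_to_def by blast
  obtain z where z: "z > 0" "normalizing_integral B p L = ennreal z"
    using assms(2,3) by (cases "normalizing_integral B p L") auto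
  have "L \<omega> * p \<omega> / normalizing_integral B p L = ennreal (c / z) * (L \<omega> * q \<omega>)" for \<omega>
    using c z by (simp add: divide_ennreal [symmetric] divide_ennreal_def mult_ac)
  then have "posterior B p L = density B (\<lambda>\<omega>. ennreal (c / z) * (L \<omega> * q \<omega>))"
    by (simp add: posterior_def)
  with c(1) z(1) show thesis by (intro that [of "c / z"]) simp_all
qed

theorem theorem1:
  fixes \<nu> :: "'x measure" and f :: "real \<Rightarrow> 'x \<Rightarrow> real"
    and \<mu> :: "real measure" and g1 g2 :: "real \<Rightarrow> real"
    and prior :: "real \<times> real \<Rightarrow> ennreal" and x :: 'x
  assumes f_nonneg: "\<And>\<theta> y. f \<theta> y \<ge> 0"
    and f_measurable: "\<And>\<theta>. f \<theta> \<in> borel_measurable \<nu>"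
    and f_density: "\<And>\<theta>. prob_space (density \<nu> (\<lambda>y. ennreal (f \<theta> y)))"
    and f_measurable_param: "\<And>y. y \<in> space \<nu> \<Longrightarrow> (\<lambda>\<theta>. f \<theta> y) \<in> borel_measurable borel"
    and mu: "sigma_finite_measure \<mu>" "sets \<mu> = sets borel"
    and g1: "g1 \<in> borel_measurable borel" "\<And>\<theta>. g1 \<theta> \<ge> 0"
    and g2: "g2 \<in> borel_measurable borel" "\<And>\<alpha>. g2 \<alpha> \<ge> 0"
    and g2_finite: "\<And>t. (\<integral>\<^sup>+\<alpha>\<in>{..t}. ennreal (g2 \<alpha>) \<partial>\<mu>) < \<infinity>"
    and prior: "proportional_to prior
        (\<lambda>(\<theta>, \<alpha>). ennreal (g1 \<theta>) * ennreal (g2 \<alpha>) * indicator {0..} (\<theta> - \<alpha>))"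
    and x: "x \<in> space \<nu>"
    and exists_posterior:
      "0 < normalizing_integral (lborel \<Otimes>\<^sub>M \<mu>) prior (\<lambda>(\<theta>, \<alpha>). ennreal (f \<theta> x))"
      "normalizing_integral (lborel \<Otimes>\<^sub>M \<mu>) prior (\<lambda>(\<theta>, \<alpha>). ennreal (f \<theta> x)) < \<infinity>"
  shows
    "(\<exists>\<pi>1. distributed (posterior (lborel \<Otimes>\<^sub>M \<mu>) prior (\<lambda>(\<theta>, \<alpha>). ennreal (f \<theta> x))) lborel fst \<pi>1 \<and>
        proportional_to \<pi>1
          (\<lambda>\<theta>. ennreal (f \<theta> x) * ennreal (g1 \<theta>) * (\<integral>\<^sup>+\<alpha>\<in>{..\<theta>}. ennreal (g2 \<alpha>) \<partial>\<mu>))) \<and>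
     ((\<forall>s. (\<integral>\<^sup>+\<theta>\<in>{s..}. ennreal (g1 \<theta>) \<partial>lborel) < \<infinity>) \<longrightarrow>
      (\<exists>\<pi>2. distributed (posterior (lborel \<Otimes>\<^sub>M \<mu>) prior (\<lambda>(\<theta>, \<alpha>). ennreal (f \<theta> x))) \<mu> snd \<pi>2 \<and>
        proportional_to \<pi>2
          (\<lambda>\<alpha>. ennreal (g2 \<alpha>) * (\<integral>\<^sup>+\<theta>\<in>{\<alpha>..}. ennreal (f \<theta> x) * ennreal (g1 \<theta>) \<partial>lborel))))"
proof -
  interpret \<mu>: sigma_finite_measure \<mu> by (rule mu(1))
  interpret pair_sigma_finite lborel \<mu> by unfold_locales
  note [measurable] = g1(1) g2(1) f_measurable_param [OF x]
  note [measurable_cong] = mu(2)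
  let ?P = "posterior (lborel \<Otimes>\<^sub>M \<mu>) prior (\<lambda>(\<theta>, \<alpha>). ennreal (f \<theta> x))"
  obtain d where d: "d > 0"
    and P: "?P = density (lborel \<Otimes>\<^sub>M \<mu>) (\<lambda>\<omega>. ennreal d *
      ((case \<omega> of (\<theta>, \<alpha>) \<Rightarrow> ennreal (f \<theta> x)) *
       (case \<omega> of (\<theta>, \<alpha>) \<Rightarrow> ennreal (g1 \<theta>) * ennreal (g2 \<alpha>) * indicator {0..} (\<theta> - \<alpha>))))"
    (is "_ = density _ ?h")
    using posterior_density_proportional [OF prior exists_posterior] by blast
  have h [measurable]: "?h \<in> borel_measurable (lborel \<Otimes>\<^sub>M \<mu>)"
    by measurable
  \<comment> \<open>The two ways to read \<open>0 \<le> \<theta> - \<alpha>\<close>: as a constraint on \<open>\<alpha>\<close>, and as one on \<open>\<theta>\<close>.\<close>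
  have h_\<theta>: "?h (\<theta>, \<alpha>) = (ennreal d * (ennreal (f \<theta> x) * ennreal (g1 \<theta>))) *
      (ennreal (g2 \<alpha>) * indicator {..\<theta>} \<alpha>)" for \<theta> \<alpha>
    by (simp add: mult_ac split: split_indicator)
  have h_\<alpha>: "?h (\<theta>, \<alpha>) = (ennreal d * ennreal (g2 \<alpha>)) *
      (ennreal (f \<theta> x) * ennreal (g1 \<theta>) * indicator {\<alpha>..} \<theta>)" for \<theta> \<alpha>
    by (simp add: mult_ac split: split_indicator)
  have "distributed ?P lborel fst (\<lambda>\<theta>. \<integral>\<^sup>+\<alpha>. ?h (\<theta>, \<alpha>) \<partial>\<mu>)"
    unfolding P by (rule distributed_fst_density [OF h])
  moreover have "(\<integral>\<^sup>+\<alpha>. ?h (\<theta>, \<alpha>) \<partial>\<mu>) = ennreal d *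
      (ennreal (f \<theta> x) * ennreal (g1 \<theta>) * (\<integral>\<^sup>+\<alpha>\<in>{..\<theta>}. ennreal (g2 \<alpha>) \<partial>\<mu>))" for \<theta>
    unfolding h_\<theta> by (subst nn_integral_cmult) (simp_all add: mult.assoc)
  moreover have "distributed ?P \<mu> snd (\<lambda>\<alpha>. \<integral>\<^sup>+\<theta>. ?h (\<theta>, \<alpha>) \<partial>lborel)"
    unfolding P by (rule distributed_snd_density [OF h])
  moreover have "(\<integral>\<^sup>+\<theta>. ?h (\<theta>, \<alpha>) \<partial>lborel) = ennreal d *
      (ennreal (g2 \<alpha>) * (\<integral>\<^sup>+\<theta>\<in>{\<alpha>..}. ennreal (f \<theta> x) * ennreal (g1 \<theta>) \<partial>lborel))" for \<alpha>
    unfolding h_\<alpha> by (subst nn_integral_cmult) (simp_all add: mult.assoc)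
  ultimately show ?thesis
    using d unfolding proportional_to_def by blast
qed

end
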